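(* Let $x^k$ be a sequence of primal feasible points (i.e., $x^k \in \mathbb{R}^n$, $x^k \ge 0$) that converges to a primal optimal point $x^\ast$ of $\min\{ f(Ax) : x \ge 0\}$, and let $\nu^{\mathrm{strict}} \in \mathbb{R}^m$ be a strictly dual feasible point (i.e., $A^T\nu^{\mathrm{strict}} > 0$ componentwise). For each $k$, define the dual feasible point $\hat{\nu}^k$ by performing the dual line search using $\nu'^k = \nabla f(Ax^k)$ and $\nu^{\mathrm{strict}}$; that is, $\hat{\nu}^k = (1-t^k)\nu'^k + t^k \nu^{\mathrm{strict}}$, where $t^k$ is the smallest $t \in [0,1]$ such that $A^T\big((1-t)\nu'^k + t\nu^{\mathrm{strict}}\big) \ge 0$. Then the sequence $\hat{\nu}^k$ of dual feasible points converges to the unique dual optimal point $\nu^\ast$, i.e., the unique maximizer of $g(\nu) = -f^\ast(\nu)$ subject to $A^T\nu \ge 0$.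
   Context: Standing assumptions: $f:\mathbb{R}^m\to\overline{\mathbb{R}}=\mathbb{R}\cup\{\pm\infty\}$ is a proper, convex, extended-value function with globally $L$-Lipschitz continuous gradient, $L>0$; $A$ is a real $m\times n$ matrix with full rank; and $\operatorname{int}(\operatorname{dom} f)\cap A\mathbb{R}^n_+$ is non-empty, where $\mathbb{R}^n_+=\{x\in\mathbb{R}^n : x\ge 0\}$. Vector inequalities are componentwise. The primal problem is $p^\ast = \min_x f(Ax)$ subject to $x\ge 0$. With the convex conjugate $f^\ast(y)=\sup_z \langle y,z\rangle - f(z)$ and $g(\nu) = -f^\ast(\nu)$, the dual problem is $d^\ast=\max_\nu g(\nu)$ subject to $A^T\nu\ge 0$. A point $x$ is primal feasible if $x\ge0$; a point $\nu$ is dual feasible if $A^T\nu\ge0$. The function $g$ is $1/L$-strongly concave, strong duality holds ($p^\ast=d^\ast$), and the dual optimal point $\nu^\ast$ is unique. Dual line search: given $\nu'\in\mathbb{R}^m$ and a dual feasible $\nu^{\mathrm{strict}}$, let $t^\ast$ be the minimum of $t$ subject to $A^T((1-t)\nu'+t\nu^{\mathrm{strict}})\ge 0$ and $0\le t\le 1$, and return $\hat\nu=(1-t^\ast)\nu'+t^\ast\nu^{\mathrm{strict}}$. *)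

theory Defs
  imports "HOL-Analysis.Analysis"
begin

section \<open>Extended-valued functions\<close>

definition edom :: "('a \<Rightarrow> ereal) \<Rightarrow> 'a set" where
  "edom f = {z. f z < \<infinity>}"

definition proper_fun :: "('a \<Rightarrow> ereal) \<Rightarrow> bool" where
  "proper_fun f \<longleftrightarrow> edom f \<noteq> {} \<and> (\<forall>z. f z \<noteq> -\<infinity>)"

text \<open>Convexity through the real epigraph, which avoids the undefined sum of the two infinities
  in Jensen's inequality.\<close>

definition convex_fun :: "('a::real_vector \<Rightarrow> ereal) \<Rightarrow> bool" where
  "convex_fun f \<longleftrightarrow> convex {(z, r::real). f z \<le> ereal r}"

text \<open>Differentiability requires finiteness near the point; otherwise
  \<^const>\<open>real_of_ereal\<close>, which sends both infinities to 0, would create spurious gradients.\<close>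

definition has_egradient :: "('a::real_inner \<Rightarrow> ereal) \<Rightarrow> 'a \<Rightarrow> 'a \<Rightarrow> bool" where
  "has_egradient f z d \<longleftrightarrow>
     (\<forall>\<^sub>F w in nhds z. \<bar>f w\<bar> \<noteq> \<infinity>) \<and> GDERIV (\<lambda>w. real_of_ereal (f w)) z :> d"

definition egradient :: "('a::real_inner \<Rightarrow> ereal) \<Rightarrow> 'a \<Rightarrow> 'a" where
  "egradient f z = (THE d. has_egradient f z d)"

text \<open>``Globally'' means that the gradient exists at every point of the space. A Lipschitz gradient
  merely on the interior of the domain would not make the conjugate strongly convex: the conjugate
  of the indicator function of a ball is a support function.\<close>

definition lipschitz_gradient :: "real \<Rightarrow> ('a::real_inner \<Rightarrow> ereal) \<Rightarrow> bool" where
  "lipschitz_gradient L f \<longleftrightarrow>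
     (\<forall>z. \<exists>d. has_egradient f z d) \<and> L-lipschitz_on UNIV (egradient f)"

definition conjugate :: "('a::real_inner \<Rightarrow> ereal) \<Rightarrow> 'a \<Rightarrow> ereal" where
  "conjugate f y = (SUP z. ereal (y \<bullet> z) - f z)"


section \<open>The primal and dual problems\<close>

definition full_rank :: "real^'n^'m \<Rightarrow> bool" where
  "full_rank A \<longleftrightarrow> rank A = min CARD('m) CARD('n)"

definition primal_feasible :: "real^'n \<Rightarrow> bool" where
  "primal_feasible x \<longleftrightarrow> 0 \<le> x"

definition primal_optimal :: "(real^'m \<Rightarrow> ereal) \<Rightarrow> real^'n^'m \<Rightarrow> real^'n \<Rightarrow> bool" where
  "primal_optimal f A x \<longleftrightarrow>
     primal_feasible x \<and> (\<forall>y. primal_feasible y \<longrightarrow> f (A *v x) \<le> f (A *v y))"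

definition dual_objective :: "(real^'m \<Rightarrow> ereal) \<Rightarrow> real^'m \<Rightarrow> ereal" where
  "dual_objective f \<nu> = - conjugate f \<nu>"

definition dual_feasible :: "real^'n^'m \<Rightarrow> real^'m \<Rightarrow> bool" where
  "dual_feasible A \<nu> \<longleftrightarrow> 0 \<le> transpose A *v \<nu>"

text \<open>The library's strict order on vectors is not the componentwise one.\<close>

definition strictly_dual_feasible :: "real^'n^'m \<Rightarrow> real^'m \<Rightarrow> bool" where
  "strictly_dual_feasible A \<nu> \<longleftrightarrow> (\<forall>j. 0 < (transpose A *v \<nu>) $ j)"

definition dual_optimal :: "(real^'m \<Rightarrow> ereal) \<Rightarrow> real^'n^'m \<Rightarrow> real^'m \<Rightarrow> bool" where
  "dual_optimal f A \<nu> \<longleftrightarrow>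
     dual_feasible A \<nu> \<and> (\<forall>\<mu>. dual_feasible A \<mu> \<longrightarrow> dual_objective f \<mu> \<le> dual_objective f \<nu>)"


section \<open>Dual line search\<close>

definition line_search_step :: "real^'n^'m \<Rightarrow> real^'m \<Rightarrow> real^'m \<Rightarrow> real" where
  "line_search_step A \<nu>' \<nu>s =
     (LEAST t. 0 \<le> t \<and> t \<le> 1 \<and> 0 \<le> transpose A *v ((1 - t) *\<^sub>R \<nu>' + t *\<^sub>R \<nu>s))"

definition dual_line_search :: "real^'n^'m \<Rightarrow> real^'m \<Rightarrow> real^'m \<Rightarrow> real^'m" where
  "dual_line_search A \<nu>' \<nu>s =
     (let t = line_search_step A \<nu>' \<nu>s in (1 - t) *\<^sub>R \<nu>' + t *\<^sub>R \<nu>s)"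

end

theory Submission
  imports Defs
begin

text \<open>
  A globally defined gradient forces \<open>f\<close> to be finite everywhere, so \<open>f\<close> is a differentiable convex
  function \<open>\<phi>\<close> on the whole space, and the limit is \<open>\<nu>\<^sup>* = \<nabla>\<phi>(Ax\<^sup>*)\<close>.

  That \<open>\<nu>\<^sup>*\<close> is the dual optimum comes from the optimality conditions of the primal problem
  (\<open>primal_optimal_KKT\<close>): since \<open>\<phi>\<close> is minimal over the cone \<open>A\<real>\<^sup>n\<^sub>+\<close> at \<open>Ax\<^sup>*\<close>, the vector
  \<open>A\<^sup>T\<nu>\<^sup>*\<close> is nonnegative and orthogonal to \<open>x\<^sup>*\<close>. Evaluating the supremum that defines the conjugate
  at \<open>Ax\<^sup>*\<close> gives \<open>f\<^sup>*(\<mu>) \<ge> \<langle>A\<^sup>T\<mu>, x\<^sup>*\<rangle> - \<phi>(Ax\<^sup>*) \<ge> -\<phi>(Ax\<^sup>*)\<close> for every dual feasible \<open>\<mu>\<close>, and the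
  gradient inequality says that \<open>\<nu>\<^sup>*\<close> attains this bound. If another feasible \<open>\<nu>\<close> attains it,
  then \<open>Ax\<^sup>*\<close> maximizes \<open>\<langle>\<nu>, z\<rangle> - \<phi>(z)\<close>, whose gradient vanishes there, so \<open>\<nu> = \<nu>\<^sup>*\<close>
  (\<open>conjugate_attained_imp_gradient\<close>).

  For the convergence, continuity of the gradient gives \<open>\<nabla>\<phi>(Ax\<^sup>k) \<rightarrow> \<nu>\<^sup>*\<close>. The limit \<open>\<nu>\<^sup>*\<close> is feasible,
  so mixing it with any positive amount \<open>\<epsilon>\<close> of the strictly feasible point makes all constraints
  strict; strict constraints survive small perturbations, so the mixture with weight \<open>\<epsilon>\<close> is
  eventually feasible and the line search step is eventually at most \<open>\<epsilon>\<close>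
  (\<open>line_search_step_tendsto_0\<close>). Hence the steps tend to 0, and the line search moves the points
  \<open>\<nabla>\<phi>(Ax\<^sup>k)\<close> by a vanishing amount.
\<close>


section \<open>First-order conditions for differentiable convex functions\<close>

lemma GDERIV_along_line:
  fixes \<phi> :: "'a::real_inner \<Rightarrow> real"
  assumes "GDERIV \<phi> z :> d"
  shows "((\<lambda>s. \<phi> (z + s *\<^sub>R v)) has_real_derivative d \<bullet> v) (at 0)"
proof -
  have "(\<phi> has_derivative (\<lambda>h. h \<bullet> d)) (at (z + 0 *\<^sub>R v))"
    using assms by (simp add: gderiv_def)
  moreover have "((\<lambda>s. z + s *\<^sub>R v) has_derivative (\<lambda>s. s *\<^sub>R v)) (at 0)"
    by (auto intro!: derivative_eq_intros)
  ultimately have "((\<lambda>s. \<phi> (z + s *\<^sub>R v)) has_derivative (\<lambda>s. (s *\<^sub>R v) \<bullet> d)) (at 0)"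
    using has_derivative_compose[where f = "\<lambda>s. z + s *\<^sub>R v" and g = \<phi> and x = 0 and s = UNIV]
    by blast
  then show ?thesis
    by (simp add: has_field_derivative_def inner_commute mult_commute_abs)
qed

lemma GDERIV_unique:
  assumes "GDERIV \<phi> z :> d" and "GDERIV \<phi> z :> d'"
  shows "d = d'"
proof -
  have "(\<lambda>h. h \<bullet> d) = (\<lambda>h. h \<bullet> d')"
    using assms has_derivative_unique unfolding gderiv_def by blast
  then show ?thesis
    by (metis vector_eq_ldot)
qed

lemma convex_on_gradient_inequality:
  fixes \<phi> :: "'a::real_inner \<Rightarrow> real"
  assumes convex: "convex_on UNIV \<phi>" and grad: "GDERIV \<phi> z :> d"
  shows "\<phi> z + d \<bullet> (w - z) \<le> \<phi> w"
proof -
  define h where "h s = \<phi> (z + s *\<^sub>R (w - z))" for s :: real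
  have "convex_on UNIV h"
  proof (rule convex_onI)
    fix t a b :: real
    assume t: "0 < t" "t < 1"
    have "z + ((1 - t) *\<^sub>R a + t *\<^sub>R b) *\<^sub>R (w - z)
        = (1 - t) *\<^sub>R (z + a *\<^sub>R (w - z)) + t *\<^sub>R (z + b *\<^sub>R (w - z))"
      by (simp add: algebra_simps)
    then show "h ((1 - t) *\<^sub>R a + t *\<^sub>R b) \<le> (1 - t) * h a + t * h b"
      using convex_onD[OF convex, of t "z + a *\<^sub>R (w - z)" "z + b *\<^sub>R (w - z)"] t
      by (simp add: h_def)
  qed simp
  moreover have "(h has_real_derivative d \<bullet> (w - z)) (at 0)"
    unfolding h_def by (rule GDERIV_along_line[OF grad])
  ultimately have "(d \<bullet> (w - z)) * (1 - 0) \<le> h 1 - h 0"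
    by (intro convex_on_imp_above_tangent[where A = UNIV]) auto
  then show ?thesis
    by (simp add: h_def)
qed

text \<open>If the slope \<open>\<langle>d, w - z\<rangle>\<close> were negative, \<open>\<phi>\<close> would decrease strictly on the initial part of
  the segment from \<open>z\<close> to \<open>w\<close>, which convexity keeps inside \<open>S\<close>.\<close>

lemma minimum_imp_variational_inequality:
  fixes \<phi> :: "'a::real_inner \<Rightarrow> real"
  assumes "convex S" and "z \<in> S" and "w \<in> S"
    and grad: "GDERIV \<phi> z :> d"
    and min: "\<And>y. y \<in> S \<Longrightarrow> \<phi> z \<le> \<phi> y"
  shows "0 \<le> d \<bullet> (w - z)"
proof (rule ccontr)
  assume "\<not> 0 \<le> d \<bullet> (w - z)"
  then obtain \<delta> where "\<delta> > 0"
    and dec: "\<And>s. 0 < s \<Longrightarrow> s < \<delta> \<Longrightarrow> \<phi> (z + s *\<^sub>R (w - z)) < \<phi> z"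
    using DERIV_neg_dec_right[OF GDERIV_along_line[OF grad, of "w - z"]] by auto
  define s where "s = min (\<delta> / 2) 1"
  have s: "0 < s" "s < \<delta>" "s \<le> 1"
    using \<open>\<delta> > 0\<close> by (auto simp: s_def)
  have "(1 - s) *\<^sub>R z + s *\<^sub>R w \<in> S"
    using assms(1-3) s by (simp add: convex_alt)
  moreover have "(1 - s) *\<^sub>R z + s *\<^sub>R w = z + s *\<^sub>R (w - z)"
    by (simp add: algebra_simps)
  ultimately show False
    using min dec s by (metis not_less)
qed


section \<open>From extended-valued to real-valued functions\<close>

lemma egradient_eqI:
  assumes "has_egradient f z d"
  shows "egradient f z = d"
  unfolding egradient_def
  using assms GDERIV_unique by (intro the_equality) (auto simp: has_egradient_def)

lemma has_egradient_finite:
  assumes "has_egradient f z d"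
  shows "\<bar>f z\<bar> \<noteq> \<infinity>"
  using assms unfolding has_egradient_def by (auto dest: eventually_nhds_x_imp_x)

lemma convex_fun_imp_convex_on:
  assumes "convex_fun (\<lambda>z. ereal (\<phi> z))"
  shows "convex_on UNIV \<phi>"
proof -
  have "epigraph UNIV \<phi> = {(z, r). ereal (\<phi> z) \<le> ereal r}"
    by (auto simp: epigraph_def)
  then show ?thesis
    using assms by (simp add: convex_fun_def flip: convex_epigraph)
qed

text \<open>The reduction on which everything else rests: what the hypotheses on \<open>f\<close> amount to for a
  real-valued function.\<close>

lemma lipschitz_gradient_real_valued:
  assumes "convex_fun f" and "lipschitz_gradient L f"
  obtains \<phi> where "f = (\<lambda>z. ereal (\<phi> z))" and "convex_on UNIV \<phi>"
    and "\<And>z. GDERIV \<phi> z :> egradient f z" and "continuous_on UNIV (egradient f)"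
proof -
  have grad: "has_egradient f z (egradient f z)" for z
    using assms(2) egradient_eqI unfolding lipschitz_gradient_def by metis
  define \<phi> where "\<phi> z = real_of_ereal (f z)" for z
  have f: "f = (\<lambda>z. ereal (\<phi> z))"
    using has_egradient_finite[OF grad] by (simp add: \<phi>_def ereal_real fun_eq_iff)
  moreover have "convex_on UNIV \<phi>"
    using convex_fun_imp_convex_on assms(1) f by metis
  moreover have "GDERIV \<phi> z :> egradient f z" for z
    using grad by (simp add: has_egradient_def \<phi>_def[abs_def])
  moreover have "continuous_on UNIV (egradient f)"
    using assms(2) lipschitz_on_continuous_on unfolding lipschitz_gradient_def by blast
  ultimately show ?thesis
    using that by blast
qed


section \<open>The conjugate function\<close>

lemma conjugate_lower_bound: "ereal (y \<bullet> z - \<phi> z) \<le> conjugate (\<lambda>z. ereal (\<phi> z)) y"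
  unfolding conjugate_def by (rule SUP_upper2[of z]) auto

text \<open>Equality in the Fenchel-Young inequality holds at a gradient, and for a differentiable function
  only there: a maximizer of \<open>\<langle>y, z\<rangle> - \<phi>(z)\<close> is a critical point.\<close>

lemma conjugate_gradient:
  assumes "convex_on UNIV \<phi>" and "GDERIV \<phi> z :> d"
  shows "conjugate (\<lambda>z. ereal (\<phi> z)) d = ereal (d \<bullet> z - \<phi> z)"
proof (rule antisym)
  show "conjugate (\<lambda>z. ereal (\<phi> z)) d \<le> ereal (d \<bullet> z - \<phi> z)"
    unfolding conjugate_def
  proof (rule SUP_least)
    fix w
    show "ereal (d \<bullet> w) - ereal (\<phi> w) \<le> ereal (d \<bullet> z - \<phi> z)"
      using convex_on_gradient_inequality[OF assms, of w] by (simp add: inner_diff_right)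
  qed
qed (rule conjugate_lower_bound)

lemma conjugate_attained_imp_gradient:
  fixes \<phi> :: "'a::real_inner \<Rightarrow> real"
  assumes grad: "GDERIV \<phi> z :> d"
    and attained: "conjugate (\<lambda>z. ereal (\<phi> z)) y \<le> ereal (y \<bullet> z - \<phi> z)"
  shows "y = d"
proof -
  have "GDERIV (\<lambda>w. \<phi> w - y \<bullet> w) z :> d - y"
  proof -
    have "((\<lambda>w. y \<bullet> w) has_derivative (\<lambda>h. h \<bullet> y)) (at z)"
      by (auto intro!: derivative_eq_intros simp: inner_commute)
    then show ?thesis
      using grad has_derivative_diff unfolding gderiv_def inner_diff_right by blast
  qed
  moreover have "\<phi> z - y \<bullet> z \<le> \<phi> w - y \<bullet> w" for w
    using order_trans[OF conjugate_lower_bound attained, of w] by simp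
  \<comment> \<open>the direction opposite to the gradient \<open>d - y\<close>\<close>
  ultimately have "0 \<le> (d - y) \<bullet> ((z - (d - y)) - z)"
    by (intro minimum_imp_variational_inequality[where S = UNIV]) auto
  then have "(d - y) \<bullet> (d - y) \<le> 0"
    by (simp add: inner_diff_left inner_diff_right)
  then show ?thesis
    by (metis inner_gt_zero_iff not_less right_minus_eq)
qed


section \<open>Optimality in the primal and dual problems\<close>

lemma inner_nonneg_vec:
  fixes x y :: "real^'n"
  assumes "0 \<le> x" and "0 \<le> y"
  shows "0 \<le> x \<bullet> y"
  using assms by (auto simp: inner_vec_def less_eq_vec_def intro!: sum_nonneg)

lemma inner_matrix_vector_mult_nonneg:
  assumes "dual_feasible A \<nu>" and "primal_feasible x"
  shows "0 \<le> \<nu> \<bullet> (A *v x)"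
proof -
  have "\<nu> \<bullet> (A *v x) = (transpose A *v \<nu>) \<bullet> x"
    by (simp add: dot_lmul_matrix)
  then show ?thesis
    using assms inner_nonneg_vec unfolding dual_feasible_def primal_feasible_def by metis
qed

text \<open>The cone of primal points is tested in three directions: adding a unit vector to \<open>x\<close> gives
  feasibility of the gradient, and moving \<open>x\<close> along its own ray, both towards and away from the
  origin, gives complementary slackness.\<close>

lemma primal_optimal_KKT:
  fixes \<phi> :: "real^'m \<Rightarrow> real" and A :: "real^'n^'m"
  assumes opt: "primal_optimal (\<lambda>z. ereal (\<phi> z)) A x" and grad: "GDERIV \<phi> (A *v x) :> d"
  shows "dual_feasible A d" and "d \<bullet> (A *v x) = 0"
proof -
  have x: "0 \<le> x" and min: "\<And>y. 0 \<le> y \<Longrightarrow> \<phi> (A *v x) \<le> \<phi> (A *v y)"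
    using opt by (auto simp: primal_optimal_def primal_feasible_def)
  have "convex {y::real^'n. 0 \<le> y}"
    by (auto simp: convex_def less_eq_vec_def)
  then have "convex ((*v) A ` {y. 0 \<le> y})"
    by (simp add: convex_linear_image)
  then have var: "0 \<le> d \<bullet> (A *v y - A *v x)" if "0 \<le> y" for y
    using x min that
    by (intro minimum_imp_variational_inequality[OF _ _ _ grad]) auto
  show "dual_feasible A d"
    unfolding dual_feasible_def less_eq_vec_def
  proof
    fix j
    have "0 \<le> d \<bullet> (A *v (x + axis j 1) - A *v x)"
      using x by (intro var) (auto simp: less_eq_vec_def axis_def)
    also have "\<dots> = (transpose A *v d) \<bullet> axis j 1"
      by (simp add: matrix_vector_right_distrib dot_lmul_matrix)
    finally show "0 $ j \<le> (transpose A *v d) $ j"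
      by (simp add: inner_axis)
  qed
  have "0 \<le> x + x"
    using x by (simp add: less_eq_vec_def)
  then show "d \<bullet> (A *v x) = 0"
    using var[of 0] var[of "x + x"] unfolding matrix_vector_right_distrib by simp
qed

lemma dual_optimal_gradient:
  fixes \<phi> :: "real^'m \<Rightarrow> real" and A :: "real^'n^'m"
  assumes "convex_on UNIV \<phi>"
    and opt: "primal_optimal (\<lambda>z. ereal (\<phi> z)) A x" and grad: "GDERIV \<phi> (A *v x) :> d"
  shows "dual_optimal (\<lambda>z. ereal (\<phi> z)) A \<nu> \<longleftrightarrow> \<nu> = d"
proof -
  let ?f = "\<lambda>z. ereal (\<phi> z)"
  note KKT = primal_optimal_KKT[OF opt grad]
  have x: "primal_feasible x"
    using opt by (simp add: primal_optimal_def)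
  have conj_d: "conjugate ?f d = ereal (- \<phi> (A *v x))"
    using conjugate_gradient[OF assms(1) grad] KKT(2) by simp
  have optimal: "dual_optimal ?f A d"
    unfolding dual_optimal_def
  proof (intro conjI allI impI KKT(1))
    fix \<mu>
    assume "dual_feasible A \<mu>"
    then have "ereal (- \<phi> (A *v x)) \<le> ereal (\<mu> \<bullet> (A *v x) - \<phi> (A *v x))"
      using inner_matrix_vector_mult_nonneg[OF _ x] by simp
    also have "\<dots> \<le> conjugate ?f \<mu>"
      by (rule conjugate_lower_bound)
    finally show "dual_objective ?f \<mu> \<le> dual_objective ?f d"
      by (simp only: dual_objective_def conj_d ereal_minus_le_minus)
  qed
  show ?thesis
  proof
    assume \<nu>: "dual_optimal ?f A \<nu>"
    then have feasible: "dual_feasible A \<nu>"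
      and "dual_objective ?f d \<le> dual_objective ?f \<nu>"
      using KKT(1) by (simp_all add: dual_optimal_def)
    then have "conjugate ?f \<nu> \<le> ereal (- \<phi> (A *v x))"
      by (simp only: dual_objective_def conj_d ereal_minus_le_minus)
    also have "\<dots> \<le> ereal (\<nu> \<bullet> (A *v x) - \<phi> (A *v x))"
      using inner_matrix_vector_mult_nonneg[OF feasible x] by simp
    finally show "\<nu> = d"
      by (rule conjugate_attained_imp_gradient[OF grad])
  qed (simp add: optimal)
qed


section \<open>The dual line search\<close>

text \<open>The least feasible step exists because the feasible steps form a compact set, which contains 1
  as the second endpoint is feasible.\<close>

lemma line_search_step:
  fixes A :: "real^'n^'m"
  assumes "dual_feasible A \<nu>s"
  shows line_search_step_nonneg: "0 \<le> line_search_step A \<nu>' \<nu>s"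
    and dual_feasible_dual_line_search: "dual_feasible A (dual_line_search A \<nu>' \<nu>s)"
    and line_search_step_le: "\<And>t. \<lbrakk>0 \<le> t; t \<le> 1; dual_feasible A ((1 - t) *\<^sub>R \<nu>' + t *\<^sub>R \<nu>s)\<rbrakk>
      \<Longrightarrow> line_search_step A \<nu>' \<nu>s \<le> t"
proof -
  define P where "P t \<longleftrightarrow> 0 \<le> t \<and> t \<le> 1 \<and> 0 \<le> transpose A *v ((1 - t) *\<^sub>R \<nu>' + t *\<^sub>R \<nu>s)"
    for t :: real
  have step: "line_search_step A \<nu>' \<nu>s = (LEAST t. P t)"
    by (simp add: line_search_step_def P_def)
  have "Collect P = {0..1} \<inter>
      (\<Inter>j. {t. 0 \<le> (1 - t) * (transpose A *v \<nu>') $ j + t * (transpose A *v \<nu>s) $ j})"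
    by (auto simp: P_def less_eq_vec_def matrix_vector_right_distrib matrix_vector_mult_scaleR)
  also have "compact \<dots>"
    by (intro compact_Int_closed closed_INT ballI closed_Collect_le continuous_intros) auto
  finally have "compact (Collect P)" .
  moreover have "P 1"
    using assms by (simp add: P_def dual_feasible_def)
  then have "Collect P \<noteq> {}"
    by blast
  ultimately obtain t0 where t0: "P t0" "\<And>t. P t \<Longrightarrow> t0 \<le> t"
    using compact_attains_inf[of "Collect P"] by auto
  then have eq: "line_search_step A \<nu>' \<nu>s = t0"
    unfolding step by (intro Least_equality)
  show "0 \<le> line_search_step A \<nu>' \<nu>s"
    and "dual_feasible A (dual_line_search A \<nu>' \<nu>s)"
    and "\<And>t. \<lbrakk>0 \<le> t; t \<le> 1; dual_feasible A ((1 - t) *\<^sub>R \<nu>' + t *\<^sub>R \<nu>s)\<rbrakk>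
      \<Longrightarrow> line_search_step A \<nu>' \<nu>s \<le> t"
    using t0 eq by (auto simp: P_def dual_feasible_def dual_line_search_def Let_def)
qed

lemma strictly_dual_feasible_imp_dual_feasible:
  "strictly_dual_feasible A \<nu> \<Longrightarrow> dual_feasible A \<nu>"
  by (simp add: strictly_dual_feasible_def dual_feasible_def less_eq_vec_def less_imp_le)

lemma strictly_dual_feasible_convex_combination:
  assumes "dual_feasible A \<nu>" and "strictly_dual_feasible A \<nu>s" and "0 < t" and "t \<le> 1"
  shows "strictly_dual_feasible A ((1 - t) *\<^sub>R \<nu> + t *\<^sub>R \<nu>s)"
  using assms
  by (auto simp: strictly_dual_feasible_def dual_feasible_def less_eq_vec_def
      matrix_vector_right_distrib matrix_vector_mult_scaleR intro!: add_nonneg_pos)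

lemma eventually_dual_feasible:
  assumes "(\<nu> \<longlongrightarrow> \<nu>0) F" and "strictly_dual_feasible A \<nu>0"
  shows "\<forall>\<^sub>F k in F. dual_feasible A (\<nu> k)"
proof -
  have "\<forall>\<^sub>F k in F. 0 < (transpose A *v \<nu> k) $ j" for j
  proof (rule order_tendstoD(1))
    show "((\<lambda>k. (transpose A *v \<nu> k) $ j) \<longlongrightarrow> (transpose A *v \<nu>0) $ j) F"
      by (intro tendsto_vec_nth
          bounded_linear.tendsto[OF matrix_vector_mul_bounded_linear] assms(1))
  qed (use assms(2) in \<open>simp add: strictly_dual_feasible_def\<close>)
  then have "\<forall>\<^sub>F k in F. \<forall>j. 0 < (transpose A *v \<nu> k) $ j"
    by (rule eventually_all_finite)
  then show ?thesis
    by eventually_elim (simp add: dual_feasible_def less_eq_vec_def less_imp_le)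
qed

lemma line_search_step_tendsto_0:
  assumes lim: "(\<nu> \<longlongrightarrow> \<nu>0) F" and feasible: "dual_feasible A \<nu>0"
    and strict: "strictly_dual_feasible A \<nu>s"
  shows "((\<lambda>k. line_search_step A (\<nu> k) \<nu>s) \<longlongrightarrow> 0) F"
proof (rule tendstoI)
  fix e :: real
  assume "0 < e"
  note \<nu>s = strictly_dual_feasible_imp_dual_feasible[OF strict]
  define \<epsilon> where "\<epsilon> = min (e / 2) 1"
  have \<epsilon>: "0 < \<epsilon>" "\<epsilon> \<le> 1" "\<epsilon> < e"
    using \<open>0 < e\<close> by (auto simp: \<epsilon>_def)
  have "((\<lambda>k. (1 - \<epsilon>) *\<^sub>R \<nu> k + \<epsilon> *\<^sub>R \<nu>s) \<longlongrightarrow> (1 - \<epsilon>) *\<^sub>R \<nu>0 + \<epsilon> *\<^sub>R \<nu>s) F"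
    by (intro tendsto_intros lim)
  then have "\<forall>\<^sub>F k in F. dual_feasible A ((1 - \<epsilon>) *\<^sub>R \<nu> k + \<epsilon> *\<^sub>R \<nu>s)"
    using strictly_dual_feasible_convex_combination[OF feasible strict \<epsilon>(1,2)]
    by (rule eventually_dual_feasible)
  then show "\<forall>\<^sub>F k in F. dist (line_search_step A (\<nu> k) \<nu>s) 0 < e"
  proof eventually_elim
    case (elim k)
    then have "line_search_step A (\<nu> k) \<nu>s \<le> \<epsilon>"
      using \<epsilon> by (intro line_search_step_le[OF \<nu>s]) auto
    then show ?case
      using \<epsilon>(3) line_search_step_nonneg[OF \<nu>s, of "\<nu> k"] by simp
  qed
qed

lemma dual_line_search_tendsto:
  assumes "(\<nu> \<longlongrightarrow> \<nu>0) F" and "dual_feasible A \<nu>0" and "strictly_dual_feasible A \<nu>s"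
  shows "((\<lambda>k. dual_line_search A (\<nu> k) \<nu>s) \<longlongrightarrow> \<nu>0) F"
proof -
  let ?t = "\<lambda>k. line_search_step A (\<nu> k) \<nu>s"
  have "((\<lambda>k. (1 - ?t k) *\<^sub>R \<nu> k + ?t k *\<^sub>R \<nu>s) \<longlongrightarrow> (1 - 0) *\<^sub>R \<nu>0 + 0 *\<^sub>R \<nu>s) F"
    by (intro tendsto_intros assms(1) line_search_step_tendsto_0[OF assms])
  then show ?thesis
    by (simp add: dual_line_search_def Let_def)
qed


section \<open>Convergence of the dual points\<close>

theorem theorem4p3:
  fixes f :: "real^'m \<Rightarrow> ereal"
    and A :: "real^'n^'m"
    and L :: real
    and x :: "nat \<Rightarrow> real^'n"
    and xopt :: "real^'n"
    and \<nu>strict :: "real^'m"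
  assumes "proper_fun f"
    and "convex_fun f"
    and "L > 0"
    and "lipschitz_gradient L f"
    and "full_rank A"
    and "interior (edom f) \<inter> (*v) A ` {z. 0 \<le> z} \<noteq> {}"
    and "\<And>k. primal_feasible (x k)"
    and "primal_optimal f A xopt"
    and "x \<longlonglongrightarrow> xopt"
    and "strictly_dual_feasible A \<nu>strict"
  shows "\<exists>\<nu>opt. dual_optimal f A \<nu>opt \<and>
           (\<forall>\<nu>. dual_optimal f A \<nu> \<longrightarrow> \<nu> = \<nu>opt) \<and>
           (\<forall>k. dual_feasible A (dual_line_search A (egradient f (A *v x k)) \<nu>strict)) \<and>
           (\<lambda>k. dual_line_search A (egradient f (A *v x k)) \<nu>strict) \<longlonglongrightarrow> \<nu>opt"
proof -
  obtain \<phi> where f: "f = (\<lambda>z. ereal (\<phi> z))" and convex: "convex_on UNIV \<phi>"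
    and grad: "\<And>z. GDERIV \<phi> z :> egradient f z" and cont: "continuous_on UNIV (egradient f)"
    using lipschitz_gradient_real_valued[OF assms(2,4)] by blast
  define \<nu>opt where "\<nu>opt = egradient f (A *v xopt)"
  have primal: "primal_optimal (\<lambda>z. ereal (\<phi> z)) A xopt"
    using assms(8) f by simp
  have grad_opt: "GDERIV \<phi> (A *v xopt) :> \<nu>opt"
    unfolding \<nu>opt_def by (rule grad)
  have dual: "dual_optimal f A \<nu> \<longleftrightarrow> \<nu> = \<nu>opt" for \<nu>
    using dual_optimal_gradient[OF convex primal grad_opt] f by simp
  have "(\<lambda>k. A *v x k) \<longlonglongrightarrow> A *v xopt"
    by (intro bounded_linear.tendsto[OF matrix_vector_mul_bounded_linear] assms(9))
  then have "(\<lambda>k. egradient f (A *v x k)) \<longlonglongrightarrow> \<nu>opt"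
    unfolding \<nu>opt_def by (intro continuous_on_tendsto_compose[OF cont]) auto
  then have "(\<lambda>k. dual_line_search A (egradient f (A *v x k)) \<nu>strict) \<longlonglongrightarrow> \<nu>opt"
    using primal_optimal_KKT(1)[OF primal grad_opt] assms(10) by (rule dual_line_search_tendsto)
  moreover have "dual_feasible A (dual_line_search A (egradient f (A *v x k)) \<nu>strict)" for k
    by (intro dual_feasible_dual_line_search strictly_dual_feasible_imp_dual_feasible assms(10))
  ultimately show ?thesis
    using dual by blast
qed

end
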